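(* Let $L$ be a finite-dimensional symmetric Leibniz algebra over an algebraically closed field $F$ of characteristic not two. Then $L$ is modular if and only if one of the following conditions holds: (i) $L$ is an abelian Lie algebra; (ii) $L$ is an almost abelian Lie algebra; (iii) $L=E\oplus Z$, where $Z$ is a central ideal of $L$ and $E$ is an extraspecial Leibniz algebra such that $J=\{x\in L\mid x^2=0\}$ is an abelian ideal of $L$; (iv) $L=B+Fy+Fy^2$, where $B$ is an abelian ideal of $L$, $[b,y]=b=-[y,b]$ for all $b\in B$, and $Z(L)=Fy^2$.
   Context: A symmetric Leibniz algebra over $F$ is a vector space $L$ with a bilinear product $[\cdot,\cdot]$ satisfying both $[x,[y,z]]=[[x,y],z]-[[x,z],y]$ and $[x,[y,z]]=[[x,y],z]+[y,[x,z]]$ for all $x,y,z$. Write $x^2=[x,x]$. $Z(L)=\{z\in L\mid [z,x]=[x,z]=0 \text{ for all } x\in L\}$ is the center; a central ideal is an ideal contained in $Z(L)$. A Leibniz algebra is abelian if all its products are zero. $\oplus$ denotes a direct sum of algebras (the ideals $E$ and $Z$ may include $Z=0$). $L$ is modular if $\langle U,V\rangle\cap W=\langle U,V\cap W\rangle$ for all subalgebras $U,V,W$ of $L$ with $U\subseteq W$, where $\langle\cdot,\cdot\rangle$ denotes the generated subalgebra. An almost abelian Lie algebra is a Lie algebra $M=A+Fy$ where $A\neq 0$ is an abelian ideal with $[a,y]=a=-[y,a]$ for all $a\in A$. A Leibniz algebra $E$ is extraspecial if $\dim Z(E)=1$ and $E/Z(E)$ is abelian. *)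

theory Defs
  imports
    "HOL-Computational_Algebra.Computational_Algebra"
    "HOL-Library.Set_Algebras"
begin

text \<open>
  The ambient algebra \<open>L\<close> is a whole type. Subalgebras and ideals are subsets of it, and the
  notions below that also have to apply to a subalgebra take its carrier \<open>M\<close> as an
  argument; \<open>L\<close> itself is \<open>UNIV\<close>.
\<close>

locale nonassoc_algebra = vector_space scale
  for scale :: "'f::field \<Rightarrow> 'v::ab_group_add \<Rightarrow> 'v" (infixr \<open>*s\<close> 75) +
  fixes br :: "'v \<Rightarrow> 'v \<Rightarrow> 'v"
  assumes linear_br_right: "Vector_Spaces.linear (*s) (*s) (\<lambda>y. br x y)"
    and linear_br_left: "Vector_Spaces.linear (*s) (*s) (\<lambda>x. br x y)"
begin

definition subalgebra :: "'v set \<Rightarrow> bool" where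
  "subalgebra U \<longleftrightarrow> subspace U \<and> (\<forall>x\<in>U. \<forall>y\<in>U. br x y \<in> U)"

definition generated :: "'v set \<Rightarrow> 'v set" where
  "generated S = subalgebra hull S"

definition ideal_of :: "'v set \<Rightarrow> 'v set \<Rightarrow> bool" where
  "ideal_of I M \<longleftrightarrow>
     subspace I \<and> I \<subseteq> M \<and> (\<forall>i\<in>I. \<forall>x\<in>M. br i x \<in> I \<and> br x i \<in> I)"

definition center :: "'v set \<Rightarrow> 'v set" where
  "center M = {z\<in>M. \<forall>x\<in>M. br z x = 0 \<and> br x z = 0}"

definition central_ideal_of :: "'v set \<Rightarrow> 'v set \<Rightarrow> bool" where
  "central_ideal_of I M \<longleftrightarrow> ideal_of I M \<and> I \<subseteq> center M"

definition abelian :: "'v set \<Rightarrow> bool" where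
  "abelian M \<longleftrightarrow> (\<forall>x\<in>M. \<forall>y\<in>M. br x y = 0)"

definition direct_sum :: "'v set \<Rightarrow> 'v set \<Rightarrow> 'v set \<Rightarrow> bool" where
  "direct_sum M E Z \<longleftrightarrow> ideal_of E M \<and> ideal_of Z M \<and> M = E + Z \<and> E \<inter> Z = {0}"

definition modular :: "'v set \<Rightarrow> bool" where
  "modular M \<longleftrightarrow>
     (\<forall>U V W. subalgebra U \<longrightarrow> subalgebra V \<longrightarrow> subalgebra W \<longrightarrow>
        U \<subseteq> M \<longrightarrow> V \<subseteq> M \<longrightarrow> W \<subseteq> M \<longrightarrow> U \<subseteq> W \<longrightarrow>
        generated (U \<union> V) \<inter> W = generated (U \<union> (V \<inter> W)))"

definition lie_algebra :: "'v set \<Rightarrow> bool" where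
  "lie_algebra M \<longleftrightarrow> subalgebra M \<and> (\<forall>x\<in>M. br x x = 0) \<and>
     (\<forall>x\<in>M. \<forall>y\<in>M. \<forall>z\<in>M. br x (br y z) + br y (br z x) + br z (br x y) = 0)"

definition almost_abelian_lie :: "'v set \<Rightarrow> bool" where
  "almost_abelian_lie M \<longleftrightarrow> lie_algebra M \<and>
     (\<exists>A y. M = A + span {y} \<and> A \<noteq> {0} \<and> ideal_of A M \<and> abelian A \<and>
        (\<forall>a\<in>A. br a y = a \<and> a = - br y a))"

text \<open>
  The quotient \<open>M/I\<close> is the set of cosets \<open>x +o I\<close>, with zero \<open>I\<close>.
  The product of two cosets is the union of the cosets of all products of representatives, which
  is a single coset when \<open>I\<close> is an ideal of \<open>M\<close>.
\<close>

definition quotient_algebra :: "'v set \<Rightarrow> 'v set \<Rightarrow> 'v set set" where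
  "quotient_algebra M I = (\<lambda>x. x +o I) ` M"

definition quotient_br :: "'v set \<Rightarrow> 'v set \<Rightarrow> 'v set \<Rightarrow> 'v set" where
  "quotient_br I X Y = (\<Union>x\<in>X. \<Union>y\<in>Y. br x y +o I)"

definition abelian_quotient :: "'v set \<Rightarrow> 'v set \<Rightarrow> bool" where
  "abelian_quotient M I \<longleftrightarrow>
     (\<forall>X\<in>quotient_algebra M I. \<forall>Y\<in>quotient_algebra M I. quotient_br I X Y = I)"

text \<open>A subalgebra of a Leibniz algebra is Leibniz, so no identities are required of \<open>M\<close> here.\<close>

definition extraspecial :: "'v set \<Rightarrow> bool" where
  "extraspecial M \<longleftrightarrow>
     subalgebra M \<and> dim (center M) = 1 \<and> abelian_quotient M (center M)"

end

locale symmetric_leibniz_algebra = nonassoc_algebra +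
  assumes right_leibniz: "br x (br y z) = br (br x y) z - br (br x z) y"
    and left_leibniz: "br x (br y z) = br (br x y) z + br y (br x z)"

locale finite_dimensional_symmetric_leibniz_algebra =
  symmetric_leibniz_algebra scale br + finite_dimensional_vector_space scale Basis
  for scale :: "'f::field \<Rightarrow> 'v::ab_group_add \<Rightarrow> 'v" (infixr \<open>*s\<close> 75)
    and br :: "'v \<Rightarrow> 'v \<Rightarrow> 'v" and Basis :: "'v set"

end

theory Submission
  imports Defs
begin

text \<open>
  In each of the four cases there are a subspace \<open>J\<close> and an element \<open>z\<close> such that the subalgebras are
  exactly the subspaces contained in \<open>J\<close> or containing \<open>z\<close>; hence \<open>U + V\<close> is a subalgebra for all
  subalgebras \<open>U\<close>, \<open>V\<close>, and modularity is inherited from the lattice of subspaces.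

  Conversely, squares are central in a symmetric Leibniz algebra; let \<open>leib\<close> be their span. In a
  modular algebra \<open>[x,y]\<close> lies in \<open>Fx + Fy + leib\<close> for all \<open>x\<close>, \<open>y\<close>. If some product lies outside
  \<open>leib\<close>, one finds \<open>a\<close>, \<open>y\<close> with \<open>[a,y] = a \<noteq> 0\<close>, and \<open>L\<close> is the sum of the eigenspace
  \<open>{b. [b,y] = b}\<close>, \<open>Fy\<close> and \<open>Fy\<^sup>2\<close>, which gives (iv). Otherwise all products are central, and the
  modular law even gives \<open>[x,y] \<in> Fx\<^sup>2 + Fy\<^sup>2\<close>. Then any two squares are proportional: if \<open>x\<^sup>2\<close>, \<open>y\<^sup>2\<close>
  were independent, this would force \<open>[x,y] = -[y,x]\<close>, and \<open>x + y\<close>, \<open>x - y\<close> would have the same square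
  but products outside its span. This gives (i) or (iii).
\<close>

section \<open>Bilinear products, generated subalgebras and the modular law\<close>

context nonassoc_algebra
begin

lemma br_add_left: "br (x + y) z = br x z + br y z"
  and br_scale_left: "br (c *s x) z = c *s br x z"
  and br_add_right: "br z (x + y) = br z x + br z y"
  and br_scale_right: "br z (c *s x) = c *s br z x"
  using linear_br_left[of z] linear_br_right[of z]
  by (simp_all add: Vector_Spaces.linear_iff)

lemma br_zero_left [simp]: "br 0 z = 0" and br_zero_right [simp]: "br z 0 = 0"
  using br_scale_left[of 0 0 z] br_scale_right[of z 0 0] by simp_all

lemma br_minus_left: "br (- x) z = - br x z" and br_minus_right: "br z (- x) = - br z x"
  using br_scale_left[of "-1" x z] br_scale_right[of z "-1" x] by simp_all

lemma br_diff_left: "br (x - y) z = br x z - br y z"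
  and br_diff_right: "br z (x - y) = br z x - br z y"
  using br_add_left[of x "- y" z] br_add_right[of z x "- y"]
  by (simp_all add: br_minus_left br_minus_right)

lemmas br_simps = br_add_left br_add_right br_diff_left br_diff_right
  br_scale_left br_scale_right br_minus_left br_minus_right

lemma subalgebra_subspace: "subalgebra U \<Longrightarrow> subspace U"
  by (simp add: subalgebra_def)

lemma subalgebra_br: "subalgebra U \<Longrightarrow> x \<in> U \<Longrightarrow> y \<in> U \<Longrightarrow> br x y \<in> U"
  by (simp add: subalgebra_def)

lemma subalgebra_generated: "subalgebra (generated S)"
proof -
  have "subalgebra (\<Inter>T)" if "\<forall>t\<in>T. subalgebra t" for T
    using that subspace_Inter[of T] unfolding subalgebra_def by blast
  then show ?thesis unfolding generated_def using hull_in[of subalgebra S] by blast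
qed

lemma generated_superset: "S \<subseteq> generated S"
  unfolding generated_def by (rule hull_subset)

lemma generated_minimal: "S \<subseteq> T \<Longrightarrow> subalgebra T \<Longrightarrow> generated S \<subseteq> T"
  unfolding generated_def by (rule hull_minimal)

text \<open>Bilinearity reduces closure to the spanning set: one induction over the span for each
  argument.\<close>

lemma subalgebra_span:
  assumes "\<And>a b. a \<in> S \<Longrightarrow> b \<in> S \<Longrightarrow> br a b \<in> span S"
  shows "subalgebra (span S)"
proof -
  have 1: "br x b \<in> span S" if "x \<in> span S" "b \<in> S" for x b
    using that(1)
  proof (induction rule: span_induct_alt)
    case base
    then show ?case by (simp add: span_zero)
  next
    case (step c x y)
    then show ?case using assms[OF _ that(2)] by (auto simp: br_simps intro: span_add span_scale)
  qed
  have "br x y \<in> span S" if x: "x \<in> span S" and y: "y \<in> span S" for x y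
    using y
  proof (induction rule: span_induct_alt)
    case base
    then show ?case by (simp add: span_zero)
  next
    case (step c z y)
    then show ?case using 1[OF x] by (auto simp: br_simps intro: span_add span_scale)
  qed
  then show ?thesis by (simp add: subalgebra_def)
qed

text \<open>The elementwise form in which the modular law is applied: any subalgebra
  \<open>S\<close> containing \<open>U\<close> and \<open>V \<inter> W\<close> contains the
  right-hand side of the law.\<close>

lemma modularD:
  assumes "modular UNIV" "subalgebra U" "subalgebra V" "subalgebra W" "U \<subseteq> W"
    and "x \<in> W" "x \<in> generated (U \<union> V)" "U \<subseteq> S" "V \<inter> W \<subseteq> S" "subalgebra S"
  shows "x \<in> S"
proof -
  have "generated (U \<union> V) \<inter> W = generated (U \<union> (V \<inter> W))"
    using assms(1-5) unfolding modular_def by auto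
  then have "x \<in> generated (U \<union> (V \<inter> W))" using assms by auto
  moreover have "\<dots> \<subseteq> S" using assms by (intro generated_minimal) auto
  ultimately show ?thesis by auto
qed

lemma subspace_set_plus:
  assumes "subspace U" "subspace V"
  shows "subspace (U + V)"
proof -
  have "U + V = {x + y |x y. x \<in> U \<and> y \<in> V}" by (auto simp: set_plus_def)
  then show ?thesis using subspace_sums[OF assms] by simp
qed

text \<open>If \<open>U\<close> and \<open>V\<close> both lie in \<open>J\<close>, so does
  \<open>U + V\<close>; otherwise \<open>U + V\<close> contains \<open>z\<close>. Either way
  \<open>U + V\<close> is a subalgebra, so the generated subalgebra is just the sum, and the usual
  argument for subspaces applies: if \<open>u + v \<in> W\<close> and
  \<open>u \<in> U \<subseteq> W\<close>, then \<open>v \<in> W\<close>.\<close>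

lemma modular_of_dichotomy:
  assumes J: "subspace J"
    and sub: "\<And>S. subspace S \<Longrightarrow> S \<subseteq> J \<or> z \<in> S \<Longrightarrow> subalgebra S"
    and dich: "\<And>U. subalgebra U \<Longrightarrow> U \<subseteq> J \<or> z \<in> U"
  shows "modular UNIV"
  unfolding modular_def
proof (intro allI impI)
  fix U V W
  assume U: "subalgebra U" and V: "subalgebra V" and W: "subalgebra W" and "U \<subseteq> W"
  have su: "subspace U" "subspace V" using U V by (simp_all add: subalgebra_subspace)
  have "U \<subseteq> U + V" "V \<subseteq> U + V"
    using su[THEN subspace_0] by (force simp: set_plus_def)+
  moreover have "U + V \<subseteq> J" if "U \<subseteq> J" "V \<subseteq> J"
    using that J by (auto simp: set_plus_def subset_iff intro: subspace_add)
  ultimately have "subalgebra (U + V)"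
    using dich[OF U] dich[OF V] by (intro sub subspace_set_plus su) blast
  then have gen: "generated (U \<union> V) \<subseteq> U + V"
    using \<open>U \<subseteq> U + V\<close> \<open>V \<subseteq> U + V\<close> by (intro generated_minimal) auto
  show "generated (U \<union> V) \<inter> W = generated (U \<union> (V \<inter> W))"
  proof
    show "generated (U \<union> (V \<inter> W)) \<subseteq> generated (U \<union> V) \<inter> W"
    proof
      have "generated (U \<union> (V \<inter> W)) \<subseteq> generated (U \<union> V)"
        using generated_superset[of "U \<union> V"] by (intro generated_minimal subalgebra_generated) auto
      moreover have "generated (U \<union> (V \<inter> W)) \<subseteq> W"
        using \<open>U \<subseteq> W\<close> W by (intro generated_minimal) auto
      ultimately show "x \<in> generated (U \<union> (V \<inter> W)) \<Longrightarrow> x \<in> generated (U \<union> V) \<inter> W" for x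
        by auto
    qed
    show "generated (U \<union> V) \<inter> W \<subseteq> generated (U \<union> (V \<inter> W))"
    proof
      fix x assume x: "x \<in> generated (U \<union> V) \<inter> W"
      then obtain u v where uv: "u \<in> U" "v \<in> V" "x = u + v"
        using gen by (auto simp: set_plus_def)
      then have "v = x - u" by simp
      then have "v \<in> W"
        using x uv \<open>U \<subseteq> W\<close> subspace_diff[OF subalgebra_subspace[OF W], of x u] by auto
      then have "u \<in> generated (U \<union> (V \<inter> W))" "v \<in> generated (U \<union> (V \<inter> W))"
        using uv generated_superset[of "U \<union> (V \<inter> W)"] by auto
      then show "x \<in> generated (U \<union> (V \<inter> W))"
        using uv subalgebra_generated by (auto intro: subspace_add subalgebra_subspace)
    qed
  qed
qed

lemma subspace_center: "subspace M \<Longrightarrow> subspace (center M)"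
  unfolding center_def subspace_def by (auto simp: br_simps)

text \<open>A product lies in its own coset, hence in the union defining \<open>quotient_br\<close>;
  conversely, the coset of a central element is the center itself, so the union collapses to
  it.\<close>

lemma abelian_quotient_center_iff:
  assumes "subspace E"
  shows "abelian_quotient E (center E) \<longleftrightarrow> (\<forall>x\<in>E. \<forall>y\<in>E. br x y \<in> center E)"
proof
  have C: "subspace (center E)" using assms by (rule subspace_center)
  {
    assume A: "abelian_quotient E (center E)"
    show "\<forall>x\<in>E. \<forall>y\<in>E. br x y \<in> center E"
    proof (intro ballI)
      fix x y assume "x \<in> E" "y \<in> E"
      then have "quotient_br (center E) (x +o center E) (y +o center E) = center E"
        using A unfolding abelian_quotient_def quotient_algebra_def by blast
      moreover have "w \<in> w +o center E" for w
        using subspace_0[OF C] unfolding elt_set_plus_def by force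
      then have "br x y \<in> quotient_br (center E) (x +o center E) (y +o center E)"
        unfolding quotient_br_def by blast
      ultimately show "br x y \<in> center E" by simp
    qed
  next
    assume A: "\<forall>x\<in>E. \<forall>y\<in>E. br x y \<in> center E"
    have coset: "w +o center E = center E" if "w \<in> center E" for w
    proof
      show "w +o center E \<subseteq> center E"
        using that C by (auto simp: elt_set_plus_def intro: subspace_add)
      show "center E \<subseteq> w +o center E"
      proof
        fix c assume "c \<in> center E"
        then have "c - w \<in> center E" using that C by (auto intro: subspace_diff)
        then show "c \<in> w +o center E" unfolding elt_set_plus_def by force
      qed
    qed
    have "quotient_br (center E) (x +o center E) (y +o center E) = center E"
      if "x \<in> E" "y \<in> E" for x y
    proof -
      \<comment> \<open>\<open>quotient_br\<close> is a union over representatives, so it would be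
        empty instead of \<open>center E\<close> if there were none.\<close>
      have ne: "x +o center E \<noteq> {}" "y +o center E \<noteq> {}"
        using subspace_0[OF C] by (auto simp: elt_set_plus_def)
      have "center E \<subseteq> E" by (auto simp: center_def)
      then have "u \<in> E" if "u \<in> x +o center E \<or> u \<in> y +o center E" for u
        using that \<open>x \<in> E\<close> \<open>y \<in> E\<close> assms by (auto simp: elt_set_plus_def intro: subspace_add)
      then have "br u v +o center E = center E" if "u \<in> x +o center E" "v \<in> y +o center E" for u v
        using A that by (intro coset) auto
      then show ?thesis unfolding quotient_br_def using ne by auto
    qed
    then show "abelian_quotient E (center E)"
      unfolding abelian_quotient_def quotient_algebra_def by blast
  }
qed

end

section \<open>Linear algebra: complements and eigenvectors modulo a subspace\<close>

context vector_space
begin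

lemma in_span_pair: "x \<in> span {a, b} \<longleftrightarrow> (\<exists>p q. x = scale p a + scale q b)"
proof -
  have "x - scale p a - scale q b = 0 \<longleftrightarrow> x = scale p a + scale q b" for p q
    by (simp add: diff_diff_eq)
  then show ?thesis by (simp add: span_breakdown_eq)
qed

lemma in_span_triple: "x \<in> span {a, b, c} \<longleftrightarrow> (\<exists>p q r. x = scale p a + scale q b + scale r c)"
proof -
  have "x - scale p a - scale q b - scale r c = 0 \<longleftrightarrow> x = scale p a + scale q b + scale r c" for p q r
    by (simp add: diff_diff_eq add.assoc)
  then show ?thesis by (simp add: span_breakdown_eq)
qed

text \<open>The coordinates of a common vector with respect to \<open>B\<close> are supported both
  in \<open>C\<close> and in \<open>D\<close>, so they all vanish.\<close>

lemma span_Int_span_of_disjoint: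
  assumes B: "independent B" and CD: "C \<subseteq> B" "D \<subseteq> B" "C \<inter> D = {}"
  shows "span C \<inter> span D = {0}"
proof -
  have "x = 0" if x: "x \<in> span C" "x \<in> span D" for x
  proof -
    have "representation C x = representation B x" "representation D x = representation B x"
      using representation_extend[OF B x(1) CD(1)] representation_extend[OF B x(2) CD(2)] by auto
    then have "representation C x b = 0" for b
      using representation_ne_zero[of C x b] representation_ne_zero[of D x b] CD(3) by auto
    then show ?thesis
      using sum_nonzero_representation_eq[OF independent_mono[OF B CD(1)] x(1)] by simp
  qed
  then show ?thesis by (auto simp: span_zero)
qed

text \<open>This will split off a central summand while keeping one prescribed line of the center.
  Extend \<open>z\<close> to a basis \<open>S\<close> of \<open>C\<close> and \<open>S\<close> to a
  basis of the whole space; \<open>Z\<close> is spanned by \<open>S - {z}\<close> and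
  \<open>E\<close> by all other basis vectors, \<open>z\<close> among them.\<close>

lemma exists_complement_in_subspace:
  assumes C: "subspace C" "z \<in> C" "z \<noteq> 0"
  shows "\<exists>E Z. subspace E \<and> subspace Z \<and> z \<in> E \<and> Z \<subseteq> C \<and> C \<inter> E = span {z}
    \<and> UNIV = E + Z \<and> E \<inter> Z = {0}"
proof -
  obtain S where S: "{z} \<subseteq> S" "S \<subseteq> C" "independent S" "C \<subseteq> span S"
    using maximal_independent_subset_extend[of "{z}" C] C by auto
  let ?T = "extend_basis S"
  let ?E = "span (?T - (S - {z}))" and ?Z = "span (S - {z})"
  have T: "S \<subseteq> ?T" "independent ?T" "span ?T = UNIV"
    using S by (simp_all add: extend_basis_superset independent_extend_basis)
  have EZ: "?E \<inter> ?Z = {0}" using T by (intro span_Int_span_of_disjoint[OF T(2)]) auto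
  have zE: "z \<in> ?E" using S T by (intro span_base) auto
  have ZC: "?Z \<subseteq> C" using S C by (intro span_minimal) auto
  have "?T = (?T - (S - {z})) \<union> (S - {z})" using T(1) by blast
  then have "UNIV = span ((?T - (S - {z})) \<union> (S - {z}))" using T(3) by simp
  also have "\<dots> = ?E + ?Z" unfolding span_Un by (auto simp: set_plus_def)
  finally have "UNIV = ?E + ?Z" .
  moreover have "C \<inter> ?E = span {z}"
  proof
    show "span {z} \<subseteq> C \<inter> ?E" using C zE by (intro span_minimal subspace_inter) auto
    show "C \<inter> ?E \<subseteq> span {z}"
    proof
      fix c assume c: "c \<in> C \<inter> ?E"
      have "insert z (S - {z}) = S" using S by auto
      then have "c \<in> span (insert z (S - {z}))" using c S by auto
      then obtain k where k: "c - scale k z \<in> ?Z" unfolding span_breakdown_eq by blast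
      moreover have "c - scale k z \<in> ?E" using c zE by (intro span_diff span_scale) auto
      ultimately have "c - scale k z = 0" using EZ by blast
      then show "c \<in> span {z}" by (auto simp: span_singleton)
    qed
  qed
  ultimately show ?thesis using EZ zE ZC by (intro exI[of _ ?E] exI[of _ ?Z]) auto
qed

text \<open>Split linear factors \<open>X - c\<close> off \<open>p\<close>, each time replacing
  \<open>y\<close> by \<open>T y - c y\<close>. Since \<open>p(T) y\<close> lies in \<open>U\<close>
  and \<open>y\<close> does not, some replacement enters \<open>U\<close> for the first time; the
  vector just before it is the one sought.\<close>

lemma exists_eigenvector_mod:
  assumes T: "Vector_Spaces.linear scale scale T"
    and M: "subspace M" "\<And>v. v \<in> M \<Longrightarrow> T v \<in> M" and U: "subspace U"
    and root: "\<And>p :: 'a poly. degree p > 0 \<Longrightarrow> \<exists>c. poly p c = 0"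
    and "p \<noteq> 0" "y \<in> M" "y \<notin> U" "(\<Sum>i\<le>degree p. scale (coeff p i) ((T ^^ i) y)) \<in> U"
  shows "\<exists>v\<in>M - U. \<exists>c. T v - scale c v \<in> U"
  using assms(6-9)
proof (induction "degree p" arbitrary: p y)
  case 0
  then obtain k where k: "p = [:k:]" "k \<noteq> 0" by (metis degree_eq_zeroE pCons_0_0)
  then have "scale k y \<in> U" using 0 by simp
  then have "scale (inverse k) (scale k y) \<in> U" by (rule subspace_scale[OF U])
  then have "y \<in> U" using k by simp
  then show ?case using 0 by simp
next
  case (Suc n)
  then obtain c where "poly p c = 0" using root[of p] by auto
  then obtain q where q: "p = [:-c, 1:] * q" by (metis poly_eq_0_iff_dvd dvdE)
  then have "q \<noteq> 0" using Suc.prems by auto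
  then have "degree p = Suc (degree q)" unfolding q by (subst degree_mult_eq) auto
  then have n: "n = degree q" using Suc.hyps by simp
  let ?z = "T y - scale c y"
  have T_add: "T (u + v) = T u + T v" and T_scale: "T (scale k u) = scale k (T u)" for k u v
    using T by (simp_all add: Vector_Spaces.linear_iff)
  have T_diff: "T (u - v) = T u - T v" for u v
    using T_add[of "u - v" v] by simp
  have pow: "(T ^^ i) ?z = (T ^^ Suc i) y - scale c ((T ^^ i) y)" for i
    by (induction i) (simp_all add: T_diff T_scale)
  have p: "p = pCons 0 q - smult c q" unfolding q by simp
  \<comment> \<open>The chain computes \<open>p(T) y = q(T) ?z\<close> from
    \<open>p = X q - c q\<close>: the first sum is shifted by one index, and the top term of the
    second vanishes because \<open>q\<close> has degree only \<open>n\<close>.\<close>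
  have "(\<Sum>i\<le>degree p. scale (coeff p i) ((T ^^ i) y)) =
      (\<Sum>i\<le>Suc n. scale (coeff (pCons 0 q) i) ((T ^^ i) y))
      - (\<Sum>i\<le>Suc n. scale (c * coeff q i) ((T ^^ i) y))"
    unfolding Suc.hyps(2)[symmetric] sum_subtractf[symmetric] scale_left_diff_distrib[symmetric]
    by (subst p) simp
  also have "(\<Sum>i\<le>Suc n. scale (coeff (pCons 0 q) i) ((T ^^ i) y)) =
      (\<Sum>i\<le>n. scale (coeff q i) ((T ^^ Suc i) y))"
    by (simp add: sum.atMost_Suc_shift del: sum.atMost_Suc)
  also have "(\<Sum>i\<le>Suc n. scale (c * coeff q i) ((T ^^ i) y)) =
      (\<Sum>i\<le>n. scale (c * coeff q i) ((T ^^ i) y))"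
    by (simp add: n coeff_eq_0)
  also have "(\<Sum>i\<le>n. scale (coeff q i) ((T ^^ Suc i) y)) - (\<Sum>i\<le>n. scale (c * coeff q i) ((T ^^ i) y)) =
      (\<Sum>i\<le>n. scale (coeff q i) ((T ^^ i) ?z))"
    unfolding pow sum_subtractf[symmetric] by (intro sum.cong) (simp_all add: scale_right_diff_distrib mult.commute)
  finally have "(\<Sum>i\<le>degree q. scale (coeff q i) ((T ^^ i) ?z)) \<in> U"
    using Suc.prems n by simp
  moreover have "?z \<in> M"
    using M \<open>y \<in> M\<close> by (intro subspace_diff subspace_scale) auto
  \<comment> \<open>If \<open>?z\<close> is in \<open>U\<close>, then \<open>y\<close> itself works
    with the value \<open>c\<close>; otherwise the induction hypothesis applies to \<open>?z\<close>
    and \<open>q\<close>.\<close>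
  ultimately show ?case
    using Suc.hyps(1)[OF n \<open>q \<noteq> 0\<close> \<open>?z \<in> M\<close>] Suc.prems by blast
qed

end

context finite_dimensional_vector_space
begin

text \<open>In dimension \<open>n\<close> the \<open>n + 1\<close> vectors \<open>y\<close>,
  \<open>T y\<close>, ..., \<open>(T ^^ n) y\<close> satisfy a nontrivial linear relation, whose
  coefficients form the polynomial.\<close>

lemma exists_annihilating_poly:
  "\<exists>p :: 'a poly. p \<noteq> 0 \<and> (\<Sum>i\<le>degree p. scale (coeff p i) ((T ^^ i) y)) = 0"
proof -
  let ?f = "\<lambda>i. (T ^^ i) y" and ?n = "card Basis"
  have "\<exists>c :: nat \<Rightarrow> 'a. (\<exists>i\<le>?n. c i \<noteq> 0) \<and> (\<Sum>i\<le>?n. scale (c i) (?f i)) = 0"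
  proof (cases "inj_on ?f {..?n}")
    case True
    then have "card (?f ` {..?n}) = Suc ?n" by (simp add: card_image)
    then have "dependent (?f ` {..?n})"
      using independent_card_le_dim[of "?f ` {..?n}" UNIV] by (auto simp: dimension_def)
    then obtain u v where u: "v \<in> ?f ` {..?n}" "u v \<noteq> 0" "(\<Sum>v\<in>?f ` {..?n}. scale (u v) v) = 0"
      using dependent_finite[of "?f ` {..?n}"] by blast
    then have "(\<Sum>i\<le>?n. scale (u (?f i)) (?f i)) = 0"
      by (simp add: sum.reindex[OF True])
    then show ?thesis using u by (intro exI[of _ "\<lambda>i. u (?f i)"]) auto
  next
    \<comment> \<open>Repeated iterates collapse to one element of the image set, so the relation is
      taken directly as the difference of two equal iterates.\<close>
    case False
    then obtain i j where ij: "i \<le> ?n" "j \<le> ?n" "i \<noteq> j" "?f i = ?f j"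
      unfolding inj_on_def by auto
    have "(\<Sum>k\<le>?n. scale ((if k = i then 1 else 0) - (if k = j then 1 else 0)) (?f k)) = 0"
      using ij by (simp add: scale_left_diff_distrib sum_subtractf if_distrib[of "\<lambda>c. scale c _"] cong: if_cong)
    then show ?thesis using ij
      by (intro exI[of _ "\<lambda>k. (if k = i then 1 else 0) - (if k = j then 1 else 0)"]) auto
  qed
  then obtain c :: "nat \<Rightarrow> 'a" and i where c: "i \<le> ?n" "c i \<noteq> 0" "(\<Sum>i\<le>?n. scale (c i) (?f i)) = 0"
    by blast
  define p where "p = (\<Sum>i\<le>?n. monom (c i) i)"
  have coeff: "coeff p k = (if k \<le> ?n then c k else 0)" for k
    by (simp add: p_def coeff_sum)
  have "p \<noteq> 0" using c coeff[of i] by auto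
  have "degree p \<le> ?n" by (rule degree_le) (simp add: coeff)
  then have "(\<Sum>i\<le>degree p. scale (coeff p i) (?f i)) = (\<Sum>i\<le>?n. scale (coeff p i) (?f i))"
    by (intro sum.mono_neutral_left) (auto simp: coeff_eq_0)
  also have "\<dots> = 0" using c by (simp add: coeff)
  finally show ?thesis using \<open>p \<noteq> 0\<close> by blast
qed

end

section \<open>Central squares and the Leibniz kernel\<close>

context symmetric_leibniz_algebra
begin

text \<open>With two equal arguments the right side of the right Leibniz identity cancels; the left
  identity gives the mirror image below.\<close>

lemma br_square_right [simp]: "br x (br y y) = 0"
  using right_leibniz[of x y y] by simp

lemma br_square_left [simp]: "br (br y y) x = 0"
  using left_leibniz[of y y x] by simp

text \<open>The Leibniz kernel of the whole algebra. It is central, and the product is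
  anticommutative modulo it.\<close>

definition leib :: "'b set" where
  "leib = span (range (\<lambda>x. br x x))"

lemma subspace_leib: "subspace leib" and square_in_leib: "br x x \<in> leib"
  unfolding leib_def by (auto intro: span_base)

lemma leib_central: "i \<in> leib \<Longrightarrow> br i x = 0 \<and> br x i = 0"
  unfolding leib_def
  by (induction rule: span_induct_alt) (auto simp: br_simps)

lemma leib_central_left [simp]: "i \<in> leib \<Longrightarrow> br i x = 0"
  and leib_central_right [simp]: "i \<in> leib \<Longrightarrow> br x i = 0"
  by (simp_all add: leib_central)

text \<open>Polarization of the square of \<open>x + y\<close>.\<close>

lemma br_anticommute_mod_leib: "br x y + br y x \<in> leib"
proof -
  have "br x y + br y x = br (x + y) (x + y) - br x x - br y y"
    by (simp add: br_simps)
  then show ?thesis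
    using subspace_leib square_in_leib by (auto intro: subspace_diff)
qed

lemma span_leib [simp]: "span leib = leib"
  by (simp add: subspace_leib)

lemma subalgebra_insert_leib: "subalgebra (span (insert x leib))"
  by (rule subalgebra_span) (auto intro: span_base simp: square_in_leib span_zero)

lemma in_span_insert_leib: "v \<in> span (insert x leib) \<longleftrightarrow> (\<exists>p. \<exists>i\<in>leib. v = p *s x + i)"
proof -
  have "v - p *s x \<in> leib \<longleftrightarrow> (\<exists>i\<in>leib. v = p *s x + i)" for p
    by (force simp: algebra_simps)
  then show ?thesis by (simp add: span_breakdown_eq)
qed

lemma in_span_insert2_leib:
  "v \<in> span (insert x (insert y leib)) \<longleftrightarrow> (\<exists>p q. \<exists>i\<in>leib. v = p *s x + q *s y + i)"
proof -
  have "v - p *s x - q *s y \<in> leib \<longleftrightarrow> (\<exists>i\<in>leib. v = p *s x + q *s y + i)" for p q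
    by (force simp: algebra_simps)
  then show ?thesis by (simp add: span_breakdown_eq)
qed

text \<open>Anticommutativity gives \<open>br y b = i - b\<close> with \<open>i\<close> in
  \<open>leib\<close>. The Leibniz identities give \<open>br y b = br (br y b) y\<close>, and this
  further multiplication by \<open>y\<close> removes the central \<open>i\<close>.\<close>

lemma br_eigenvector:
  assumes "br b y = b"
  shows "br y b = - b"
proof -
  obtain i where i: "i \<in> leib" "br y b = i - b"
    using br_anticommute_mod_leib[of b y] assms by (metis add_diff_cancel_left')
  have "br y b = br (br y b) y"
    using left_leibniz[of y b y] right_leibniz[of y b y] assms by simp
  then show ?thesis using i assms by (simp add: br_simps)
qed

end

section \<open>Restrictions on products from the modular law\<close>

locale modular_leibniz_algebra =
  finite_dimensional_symmetric_leibniz_algebra scale br Basis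
  for scale :: "'f::alg_closed_field \<Rightarrow> 'v::ab_group_add \<Rightarrow> 'v" (infixr \<open>*s\<close> 75)
    and br :: "'v \<Rightarrow> 'v \<Rightarrow> 'v" and Basis :: "'v set" +
  assumes modular: "modular UNIV"
    and two_neq_0: "(2 :: 'f) \<noteq> 0"
begin

text \<open>The modular law is applied to \<open>\<langle>u\<rangle>\<close>, \<open>\<langle>v\<rangle>\<close> and \<open>\<langle>u\<rangle> + F[u,v]\<close>.\<close>
lemma central_br_in_span_squares:
  assumes central: "br u v \<in> center UNIV"
  shows "br u v \<in> span {br u u, br v v}"
proof (cases "\<exists>k. v - k *s u \<in> center UNIV")
  case True
  then obtain k where "v - k *s u \<in> center UNIV" by blast
  then have "br u (v - k *s u) = 0" by (simp add: center_def)
  then have "br u v = k *s br u u" by (simp add: br_simps)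
  then show ?thesis by (simp add: span_base span_scale)
next
  case False
  define d where "d = br u v"
  have d: "br d x = 0" "br x d = 0" for x using central by (simp_all add: d_def center_def)
  have "d \<in> span {u, br u u, br v v}"
  proof (rule modularD[OF modular])
    show U: "subalgebra (span {u, br u u})" and V: "subalgebra (span {v, br v v})"
      by (rule subalgebra_span; auto intro: span_base simp: span_zero)+
    show W: "subalgebra (span {u, br u u, d})"
      by (rule subalgebra_span; auto intro: span_base simp: span_zero d)+
    show "span {u, br u u} \<subseteq> span {u, br u u, d}" by (rule span_mono) auto
    show "d \<in> span {u, br u u, d}" by (simp add: span_base)
    have "u \<in> span {u, br u u}" "v \<in> span {v, br v v}" by (simp_all add: span_base)
    then show "d \<in> generated (span {u, br u u} \<union> span {v, br v v})"
      unfolding d_def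
      using generated_superset[of "span {u, br u u} \<union> span {v, br v v}"]
      by (intro subalgebra_br[OF subalgebra_generated]) auto
    show "span {u, br u u} \<subseteq> span {u, br u u, br v v}" by (rule span_mono) auto
    show "subalgebra (span {u, br u u, br v v})"
      by (rule subalgebra_span; auto intro: span_base simp: span_zero)
    show "span {v, br v v} \<inter> span {u, br u u, d} \<subseteq> span {u, br u u, br v v}"
    proof
      fix x assume x: "x \<in> span {v, br v v} \<inter> span {u, br u u, d}"
      then obtain a b p q r where
        1: "x = a *s v + b *s br v v" and 2: "x = p *s u + q *s br u u + r *s d"
        unfolding Int_iff in_span_pair in_span_triple by blast
      \<comment> \<open>Otherwise equating the two expressions for \<open>x\<close> makes
        \<open>v\<close> a multiple of \<open>u\<close> modulo the center, which is the case already
        treated.\<close>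
      have "a = 0"
      proof (rule ccontr)
        assume "a \<noteq> 0"
        have "a *s v - p *s u \<in> center UNIV"
        proof -
          have "a *s v - p *s u = q *s br u u + r *s d - b *s br v v"
            using 1 2 by (simp add: algebra_simps)
          then show ?thesis by (simp add: center_def br_simps d)
        qed
        then have "inverse a *s (a *s v - p *s u) \<in> center UNIV"
          by (intro subspace_scale subspace_center) auto
        then show False using False \<open>a \<noteq> 0\<close> by (auto simp: scale_right_diff_distrib)
      qed
      then show "x \<in> span {u, br u u, br v v}" using 1 by (auto intro: span_scale span_base)
    qed
  qed
  then obtain p q r where pqr: "d = p *s u + q *s br u u + r *s br v v"
    unfolding in_span_triple by blast
  show ?thesis
  proof (cases "p = 0")
    case True
    then show ?thesis using pqr by (auto simp: d_def intro: span_add span_scale span_base)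
  next
    \<comment> \<open>Multiply the expression for \<open>d\<close> by \<open>v\<close> on the right:
      the squares are central, and what remains is \<open>0 = p *s d\<close>.\<close>
    case False
    have "br d v = 0" by (rule d)
    then have "p *s d = 0" using pqr by (simp add: br_simps d_def)
    then show ?thesis using False by (simp add: d_def span_zero)
  qed
qed

text \<open>
  Modulo \<open>leib\<close>, a right multiplication by \<open>x\<close> has an eigenvector \<open>v\<close> outside \<open>Fx\<close>; the modular law
  then forces the two-generated subalgebra to be \<open>Fx + Fv\<close>.
\<close>
lemma br_in_span_mod_leib: "br x y \<in> span (insert x (insert y leib))"
proof -
  let ?U = "span (insert x leib)" and ?V = "span (insert y leib)"
    and ?S = "span (insert x (insert y leib))"
  let ?M = "generated (?U \<union> ?V)"
  have S: "?U \<subseteq> ?S" "leib \<subseteq> ?S" using span_mono[of "insert x leib"] by (auto intro: span_base)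
  show ?thesis
  proof (cases "y \<in> ?U")
    case True
    then obtain p i where "i \<in> leib" "y = p *s x + i" by (auto simp: in_span_insert_leib)
    then have "br x y = p *s br x x" by (simp add: br_simps)
    then have "br x y \<in> leib" using subspace_leib square_in_leib by (simp add: subspace_scale)
    then show ?thesis using S by auto
  next
    case False
    have inM: "x \<in> ?M" "y \<in> ?M" using generated_superset[of "?U \<union> ?V"] by (auto intro: span_base)
    obtain p :: "'f poly" where "p \<noteq> 0" "(\<Sum>i\<le>degree p. coeff p i *s ((\<lambda>v. br v x) ^^ i) y) = 0"
      using exists_annihilating_poly[of "\<lambda>v. br v x" y] by blast
    then have "\<exists>v\<in>?M - ?U. \<exists>c. br v x - c *s v \<in> ?U"
      using inM False subalgebra_generated subalgebra_br[OF subalgebra_generated]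
      by (intro exists_eigenvector_mod[where p = p and y = y])
        (auto simp: linear_br_left span_zero alg_closed_imp_poly_has_root intro: subalgebra_subspace)
    then obtain v c where v: "v \<in> ?M" "v \<notin> ?U" "br v x - c *s v \<in> ?U" by blast
    then obtain q i where i: "i \<in> leib" "br v x = c *s v + q *s x + i"
      by (auto simp: in_span_insert_leib algebra_simps)
    let ?W = "span (insert v (insert x leib))"
    have UW: "?U \<subseteq> ?W" by (rule span_mono) auto
    have leibW: "leib \<subseteq> ?W" by (auto intro: span_base)
    have vx: "br v x \<in> ?W" using i in_span_insert2_leib by blast
    then have "(br x v + br v x) - br v x \<in> ?W"
      using leibW br_anticommute_mod_leib by (intro span_diff) auto
    then have "br x v \<in> ?W" by simp
    then have W: "subalgebra ?W"
      using vx leibW square_in_leib by (intro subalgebra_span) (auto simp: span_zero)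
    \<comment> \<open>Otherwise the modular law, with \<open>?U\<close> also as the target
      \<open>S\<close>, would put \<open>v\<close> into \<open>?U\<close>.\<close>
    have "\<not> ?V \<inter> ?W \<subseteq> ?U"
      using modularD[OF modular subalgebra_insert_leib subalgebra_insert_leib W UW _ v(1) order_refl _ subalgebra_insert_leib] v(2)
      by (auto intro: span_base)
    then obtain w where w: "w \<in> ?V" "w \<in> ?W" "w \<notin> ?U" by blast
    then obtain k j where j: "j \<in> leib" "w = k *s y + j" by (auto simp: in_span_insert_leib)
    have "k \<noteq> 0" using j w(3) by (auto intro: span_base)
    have "inverse k *s (w - j) \<in> ?W"
      using j leibW w by (intro span_scale span_diff) auto
    then have "y \<in> ?W" using j \<open>k \<noteq> 0\<close> by simp
    \<comment> \<open>Modulo \<open>?U\<close> the elements \<open>y\<close> and \<open>v\<close>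
      are now proportional. Solving for \<open>v\<close> puts \<open>v\<close>, then
      \<open>br v x\<close>, then \<open>br y x\<close> into \<open>?S\<close>.\<close>
    then obtain r t l where l: "l \<in> leib" "y = r *s v + t *s x + l" by (auto simp: in_span_insert2_leib)
    have "r \<noteq> 0" using l False unfolding in_span_insert_leib by (metis add_0 scale_zero_left)
    have xyS: "x \<in> ?S" "y \<in> ?S" by (auto intro: span_base)
    have "inverse r *s (y - t *s x - l) \<in> ?S"
      using l S xyS by (intro span_scale span_diff) auto
    moreover have "inverse r *s (y - t *s x - l) = v" using l \<open>r \<noteq> 0\<close> by simp
    ultimately have "v \<in> ?S" by simp
    then have "br v x \<in> ?S" using i S xyS by (auto intro!: span_add span_scale)
    moreover have "br y x = r *s br v x + t *s br x x" using l by (simp add: br_simps)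
    ultimately have "br y x \<in> ?S" using S square_in_leib by (auto intro!: span_add span_scale)
    then have "(br x y + br y x) - br y x \<in> ?S"
      using S br_anticommute_mod_leib by (intro span_diff) auto
    then show ?thesis by simp
  qed
qed

section \<open>Proportionality of squares when all products lie in the Leibniz kernel\<close>

lemma br_in_span_squares: "br u v \<in> leib \<Longrightarrow> br u v \<in> span {br u u, br v v}"
  by (rule central_br_in_span_squares) (simp add: center_def)

text \<open>For \<open>t \<noteq> 0\<close> the squares of \<open>x\<close> and
  \<open>x - t *s y\<close> are both multiples of \<open>br x x\<close>, hence so are the products
  of these two elements. But the sum of their products in the two orders has coefficient
  \<open>- (t * t)\<close> at \<open>br y y\<close>.\<close>

lemma square_coefficient_eq_0:
  assumes central: "\<And>x y. br x y \<in> leib"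
    and y: "br y y \<notin> span {br x x}"
    and xy: "br x y + br y x = s *s br x x + t *s br y y"
  shows "t = 0"
proof (rule ccontr)
  assume "t \<noteq> 0"
  \<comment> \<open>The factor \<open>t\<close> makes the contribution of the mixed products to
    \<open>br y y\<close> cancel against that of the square of \<open>t *s y\<close>.\<close>
  let ?z = "x - t *s y"
  have "br ?z ?z = br x x - t *s (br x y + br y x) + (t * t) *s br y y"
    by (simp add: br_simps algebra_simps)
  then have z: "br ?z ?z = (1 - t * s) *s br x x"
    unfolding xy by (simp add: algebra_simps)
  have "br u v \<in> span {br u u, br v v}" for u v
    by (rule br_in_span_squares[OF central])
  moreover have "span {br x x, br ?z ?z} \<subseteq> span {br x x}" "span {br ?z ?z, br x x} \<subseteq> span {br x x}"
    by (rule span_minimal; auto simp: z intro: span_base span_scale)+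
  ultimately have "br x ?z + br ?z x \<in> span {br x x}" by (blast intro: span_add)
  moreover have eq: "br x ?z + br ?z x = (2 - t * s) *s br x x - (t * t) *s br y y"
  proof -
    have "br x ?z + br ?z x = 2 *s br x x - t *s (br x y + br y x)"
      by (simp add: br_simps algebra_simps scale_left_distrib[of 1 1, simplified])
    then show ?thesis unfolding xy by (simp add: algebra_simps)
  qed
  moreover have "(2 - t * s) *s br x x \<in> span {br x x}" by (simp add: span_base span_scale)
  ultimately have "(2 - t * s) *s br x x - (br x ?z + br ?z x) \<in> span {br x x}"
    by (intro span_diff)
  then have "inverse (t * t) *s (t * t) *s br y y \<in> span {br x x}"
    unfolding eq by (intro span_scale[of "(t * t) *s br y y"]) simp
  moreover have "inverse (t * t) *s (t * t) *s br y y = br y y"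
    using \<open>t \<noteq> 0\<close> by (simp del: inverse_mult_distrib)
  ultimately show False using y by simp
qed

text \<open>If the squares were independent, the preceding lemma used in both orders would make
  \<open>x\<close> and \<open>y\<close> anticommute. Then \<open>x + y\<close> and
  \<open>x - y\<close> have the common square \<open>br x x + br y y\<close>, while their products
  in the two orders sum to twice \<open>br x x - br y y\<close>, which is no multiple of it.\<close>

lemma squares_dependent:
  assumes central: "\<And>x y. br x y \<in> leib" and x: "br x x \<noteq> 0"
  shows "br y y \<in> span {br x x}"
proof (rule ccontr)
  assume y: "br y y \<notin> span {br x x}"
  \<comment> \<open>Needed to apply the preceding lemma with \<open>x\<close> and \<open>y\<close>
    exchanged; it uses that \<open>br x x\<close> is nonzero.\<close>
  have x': "br x x \<notin> span {br y y}"
  proof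
    assume "br x x \<in> span {br y y}"
    then obtain k where k: "br x x = k *s br y y" by (auto simp: span_singleton)
    then have "k \<noteq> 0" using x by auto
    then have "br y y = inverse k *s br x x" using k by simp
    then show False using y by (simp add: span_base span_scale)
  qed
  have sp: "br u v \<in> span {br u u, br v v}" for u v
    by (rule br_in_span_squares[OF central])
  have "br x y + br y x \<in> span {br x x, br y y}"
    using sp[of x y] sp[of y x] by (auto simp: insert_commute intro: span_add)
  then obtain s t where st: "br x y + br y x = s *s br x x + t *s br y y"
    unfolding in_span_pair by blast
  have "t = 0" by (rule square_coefficient_eq_0[OF central y st])
  moreover have "s = 0"
    using square_coefficient_eq_0[OF central x', of t s] st by (simp add: add.commute)
  ultimately have c: "br x y + br y x = 0" using st by simp
  let ?u = "x + y" and ?v = "x - y"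
  have u: "br ?u ?u = br x x + br y y" and v: "br ?v ?v = br x x + br y y"
    using c by (simp_all add: br_simps algebra_simps eq_neg_iff_add_eq_0)
  have "br ?u ?v \<in> span {br x x + br y y}" "br ?v ?u \<in> span {br x x + br y y}"
    using sp[of ?u ?v] sp[of ?v ?u] by (simp_all add: u v)
  then have "br ?u ?v + br ?v ?u \<in> span {br x x + br y y}" by (rule span_add)
  moreover have "br ?u ?v + br ?v ?u = 2 *s (br x x - br y y)"
    by (simp add: br_simps algebra_simps scale_left_distrib[of 1 1, simplified])
  ultimately obtain k where k: "2 *s (br x x - br y y) = k *s (br x x + br y y)"
    by (auto simp: span_singleton)
  then have eq: "(2 + k) *s br y y = (2 - k) *s br x x"
    by (simp add: algebra_simps)
  show False
  proof (cases "2 + k = 0")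
    \<comment> \<open>The coefficient of \<open>br x x\<close> is then \<open>2 - k = 4\<close>,
      nonzero because the characteristic is not two.\<close>
    case True
    then have "k = - 2" by (metis add.commute eq_neg_iff_add_eq_0)
    then have "(2 * 2) *s br x x = 0" using eq True by simp
    then show False using x two_neq_0 by (simp only: scale_eq_0_iff mult_eq_0_iff) simp
  next
    case False
    then have "br y y = inverse (2 + k) *s (2 - k) *s br x x"
      unfolding eq[symmetric] by simp
    then have "br y y \<in> span {br x x}" by (metis span_scale span_base singletonI)
    then show False using y by simp
  qed
qed

section \<open>Eigenvectors of a right multiplication, and case (iv)\<close>

lemma exists_almost_unit_element:
  assumes xy: "br x y = p *s x + q *s y + i" "i \<in> leib" "p \<noteq> 0" and n: "br x y \<notin> leib"
  shows "\<exists>a y. br a y = a \<and> a \<notin> leib"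
proof -
  \<comment> \<open>Up to a multiple of \<open>br y y\<close>, right multiplication by
    \<open>y\<close> scales \<open>?b\<close> by \<open>p\<close>. Dividing \<open>y\<close> by
    \<open>p\<close> makes the factor 1, and the extra multiplication in \<open>?a\<close> absorbs
    the central error.\<close>
  let ?y = "inverse p *s y" and ?b = "br x y"
  let ?a = "br ?b ?y"
  have "?b = p *s x + q *s y + i" by (rule xy(1))
  then have "br ?b y = p *s ?b + q *s br y y"
    using xy(2) by (metis add.right_neutral br_add_left br_scale_left leib_central_left)
  then have a: "?a = ?b + (inverse p * q) *s br y y"
    using xy(3) by (simp add: br_scale_right scale_right_distrib)
  then have "br ?a ?y = ?a" by (simp add: br_simps)
  moreover have "?a \<notin> leib"
  proof
    assume "?a \<in> leib"
    then have "?a - (inverse p * q) *s br y y \<in> leib"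
      using subspace_leib square_in_leib by (intro subspace_diff subspace_scale)
    then show False using a n by simp
  qed
  ultimately show ?thesis by blast
qed

text \<open>Expand \<open>br x y\<close> and \<open>br (x + a) y\<close> modulo \<open>leib\<close>.
  If the coefficients of \<open>x\<close> differ, then \<open>x\<close> is a combination of
  \<open>a\<close>, \<open>y\<close> and \<open>leib\<close>; if they agree, their common value is 1
  and \<open>x\<close> is an eigenvector up to a correction in \<open>Fy + leib\<close>.\<close>

lemma eigenspace_decomposition:
  assumes a: "br a y = a" "a \<notin> leib"
  obtains b p i where "br b y = b" "i \<in> leib" "x = b + p *s y + i"
proof -
  \<comment> \<open>Right multiplication by \<open>y\<close> fixes \<open>a\<close> but sends
    \<open>Fy + leib\<close> into \<open>leib\<close>.\<close>
  have na: "a \<noteq> p *s y + i" if "i \<in> leib" for p i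
  proof
    assume "a = p *s y + i"
    then have "br a y = p *s br y y" using that by (simp add: br_simps)
    then have "a \<in> leib" using a subspace_leib square_in_leib by (simp add: subspace_scale)
    then show False using a by simp
  qed
  obtain k m i where kmi: "i \<in> leib" "br (x + a) y = k *s (x + a) + m *s y + i"
    using br_in_span_mod_leib[of "x + a" y] unfolding in_span_insert2_leib by blast
  obtain l n j where lnj: "j \<in> leib" "br x y = l *s x + n *s y + j"
    using br_in_span_mod_leib[of x y] unfolding in_span_insert2_leib by blast
  have "l *s x + n *s y + j + a = k *s (x + a) + m *s y + i"
    using kmi lnj a by (simp add: br_add_left)
  then have eq: "(k - l) *s x = (1 - k) *s a + (n - m) *s y + (j - i)"
    by (simp add: algebra_simps)
  have ji: "j - i \<in> leib" "i - j \<in> leib" using kmi lnj subspace_leib by (auto intro: subspace_diff)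
  show thesis
  proof (cases "k = l")
    case False
    let ?b = "inverse (k - l) *s (1 - k) *s a"
    have "x = inverse (k - l) *s (k - l) *s x" using False by simp
    also have "\<dots> = ?b + (inverse (k - l) * (n - m)) *s y + inverse (k - l) *s (j - i)"
      unfolding eq by (simp only: scale_right_distrib scale_scale)
    finally show thesis
      using ji subspace_leib by (intro that[of ?b]) (auto simp: br_simps a intro: subspace_scale)
  next
    case True
    have "k = 1"
    proof (rule ccontr)
      assume k: "k \<noteq> 1"
      have "(1 - k) *s a = (m - n) *s y + (i - j)" using eq True by (simp add: algebra_simps)
      then have "inverse (1 - k) *s (1 - k) *s a = inverse (1 - k) *s ((m - n) *s y + (i - j))" by simp
      then have "a = (inverse (1 - k) * (m - n)) *s y + inverse (1 - k) *s (i - j)"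
        using k by (simp only: scale_right_distrib scale_scale) simp
      then show False using na subspace_leib ji by (auto intro: subspace_scale)
    qed
    then have x: "br x y = x + n *s y + j" using lnj True by simp
    \<comment> \<open>The last summand is the contribution of \<open>n *s y\<close> to
      \<open>br ?b y\<close>; being central, it adds nothing further.\<close>
    let ?b = "x + n *s y + j + n *s br y y"
    have "br ?b y = ?b" using lnj by (simp add: br_simps x)
    moreover have "- (j + n *s br y y) \<in> leib"
      using lnj subspace_leib square_in_leib by (intro subspace_neg subspace_add subspace_scale)
    moreover have "x = ?b + (- n) *s y + - (j + n *s br y y)" by (simp add: algebra_simps)
    ultimately show thesis by (rule that)
  qed
qed

text \<open>Right multiplication by \<open>y\<close> is a derivation, so it doubles
  \<open>br b c\<close>. On the span of \<open>b\<close>, \<open>c\<close> and \<open>leib\<close>,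
  which contains \<open>br b c\<close>, it is the identity modulo \<open>leib\<close>. Hence
  \<open>br b c\<close> is central, is killed by \<open>y\<close>, and vanishes as 2 is
  invertible.\<close>

lemma eigenvectors_commute:
  assumes b: "br b y = b" and c: "br c y = c"
  shows "br b c = 0"
proof -
  have two: "br (br b c) y = 2 *s br b c"
    using right_leibniz[of b c y] b c by (simp add: scale_left_distrib[of 1 1, simplified] algebra_simps)
  obtain p q i where i: "i \<in> leib" "br b c = p *s b + q *s c + i"
    using br_in_span_mod_leib[of b c] unfolding in_span_insert2_leib by blast
  then have "br (br b c) y = br b c - i" using b c by (simp add: br_simps)
  then have "br b c = - i" using two by (simp add: scale_left_distrib[of 1 1, simplified])
  then have "br b c \<in> leib" using i subspace_leib by (simp add: subspace_neg)
  then have "2 *s br b c = 0" using two by simp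
  then show ?thesis using two_neq_0 by simp
qed

text \<open>\<open>B\<close> is the full eigenspace for the eigenvalue 1, and every square turns out
  to be a multiple of \<open>br y y\<close>. If \<open>br y y = 0\<close>, the structure found is an
  almost abelian Lie algebra, so one description serves both kinds.\<close>

lemma nonabelian_mod_leib_structure:
  assumes "br x0 y0 \<notin> leib"
  shows "\<exists>B y. UNIV = B + span {y} + span {br y y} \<and> ideal_of B UNIV \<and> abelian B
    \<and> (\<forall>b\<in>B. br b y = b \<and> b = - br y b) \<and> center UNIV = span {br y y}"
proof -
  obtain p q i where pqi: "i \<in> leib" "br x0 y0 = p *s x0 + q *s y0 + i"
    using br_in_span_mod_leib[of x0 y0] unfolding in_span_insert2_leib by blast
  have "\<exists>a y. br a y = a \<and> a \<notin> leib"
  proof (cases "p = 0")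
    case False
    then show ?thesis using exists_almost_unit_element[OF pqi(2,1)] assms by blast
  next
    \<comment> \<open>Only \<open>y0\<close> occurs modulo \<open>leib\<close>, so the factors are
      exchanged by anticommutativity, with \<open>- q\<close> as the new leading
      coefficient.\<close>
    case True
    define j where "j = br x0 y0 + br y0 x0"
    have j: "j \<in> leib" unfolding j_def by (rule br_anticommute_mod_leib)
    have yx: "br y0 x0 = (- q) *s y0 + 0 *s x0 + (j - i)"
      using True pqi by (simp add: j_def algebra_simps)
    have ji: "j - i \<in> leib" using j pqi subspace_leib by (auto intro: subspace_diff)
    have "q \<noteq> 0" using True pqi assms by auto
    have "br y0 x0 \<notin> leib"
    proof
      assume "br y0 x0 \<in> leib"
      then have "j - br y0 x0 \<in> leib" using j subspace_leib by (intro subspace_diff)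
      then show False using assms by (simp add: j_def)
    qed
    then show ?thesis using exists_almost_unit_element[OF yx ji] \<open>q \<noteq> 0\<close> by simp
  qed
  then obtain a y where a: "br a y = a" "a \<notin> leib" by blast
  define B where "B = {b. br b y = b}"
  have B: "br b y = b" "br y b = - b" if "b \<in> B" for b
    using that br_eigenvector[of b y] by (auto simp: B_def)
  have abel: "br b c = 0" if "b \<in> B" "c \<in> B" for b c
    using that by (auto simp: B_def intro: eigenvectors_commute)
  have sB: "subspace B"
    unfolding subspace_def by (auto simp: B_def br_simps)
  have dec: "\<exists>b\<in>B. \<exists>p. \<exists>i\<in>leib. x = b + p *s y + i" for x
    using eigenspace_decomposition[OF a, of x] unfolding B_def by blast
  \<comment> \<open>In the square of \<open>b + p *s y + i\<close> the mixed products cancel,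
    because \<open>br b y = b\<close> and \<open>br y b = - b\<close>.\<close>
  have square: "br x x \<in> span {br y y}" for x
  proof -
    obtain b p i where x: "b \<in> B" "i \<in> leib" "x = b + p *s y + i" using dec[of x] by blast
    then have "br x x = (p * p) *s br y y" by (simp add: br_simps B abel algebra_simps)
    then show ?thesis by (simp add: span_base span_scale)
  qed
  have leib: "leib = span {br y y}"
  proof
    show "leib \<subseteq> span {br y y}"
      unfolding leib_def by (rule span_minimal) (auto simp: square)
    show "span {br y y} \<subseteq> leib"
      by (rule span_minimal) (auto simp: square_in_leib subspace_leib)
  qed
  have "x \<in> B + span {y} + span {br y y}" for x
  proof -
    obtain b p i where x: "b \<in> B" "i \<in> leib" "x = b + p *s y + i" using dec[of x] by blast
    have i: "i \<in> span {br y y}" using x(2) leib by blast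
    have py: "p *s y \<in> span {y}" by (simp add: span_base span_scale)
    show ?thesis unfolding x(3) by (rule set_plus_intro[OF set_plus_intro[OF x(1) py] i])
  qed
  then have "UNIV = B + span {y} + span {br y y}" by blast
  moreover have "ideal_of B UNIV"
    unfolding ideal_of_def
  proof (intro conjI ballI sB subset_UNIV)
    fix b x assume b: "b \<in> B"
    obtain c p i where x: "c \<in> B" "i \<in> leib" "x = c + p *s y + i" using dec[of x] by blast
    show "br b x \<in> B" "br x b \<in> B"
      using b x sB by (auto simp: br_simps B abel intro: subspace_scale subspace_neg)
  qed
  moreover have "abelian B" by (simp add: abelian_def abel)
  moreover have "center UNIV = span {br y y}"
  proof
    show "span {br y y} \<subseteq> center UNIV"
      unfolding leib[symmetric] by (auto simp: center_def)
    show "center UNIV \<subseteq> span {br y y}"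
    proof
      fix z assume "z \<in> center UNIV"
      then have z: "br z y = 0" "br a z = 0" by (auto simp: center_def)
      obtain b p i where bpi: "b \<in> B" "i \<in> leib" "z = b + p *s y + i" using dec[of z] by blast
      \<comment> \<open>Multiplying by the nonzero \<open>a\<close> detects the coefficient
        \<open>p\<close> of \<open>z\<close>; once it is zero, multiplying by \<open>y\<close>
        detects \<open>b\<close>.\<close>
      have "a \<in> B" "a \<noteq> 0" using a subspace_0[OF subspace_leib] by (auto simp: B_def)
      then have "p *s a = 0" using z(2) bpi a abel by (simp add: br_simps)
      then have "p = 0" using \<open>a \<noteq> 0\<close> by simp
      then have "b = 0" using z(1) bpi by (simp add: br_simps B)
      then have "z = i" using \<open>p = 0\<close> bpi(3) by simp
      then show "z \<in> span {br y y}" using bpi(2) leib by blast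
    qed
  qed
  ultimately show ?thesis using B by (intro exI[of _ B] exI[of _ y]) auto
qed

section \<open>Central products with a nonzero square, and case (iii)\<close>

lemma abelian_mod_leib_structure:
  assumes central: "\<And>x y. br x y \<in> leib" and y: "br y y \<noteq> 0"
  shows "\<exists>E Z. direct_sum UNIV E Z \<and> central_ideal_of Z UNIV \<and> extraspecial E
    \<and> ideal_of {x. br x x = 0} UNIV \<and> abelian {x. br x x = 0}"
proof -
  let ?J = "{x. br x x = 0}"
  \<comment> \<open>Two elements of square zero have product in the span of zero. This makes
    \<open>?J\<close> abelian and also closed under addition, although its defining equation is
    quadratic.\<close>
  have abel: "br u v = 0" if u: "br u u = 0" and v: "br v v = 0" for u v
    using br_in_span_squares[OF central[of u v]] unfolding u v by simp
  have "subspace ?J"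
    unfolding subspace_def by (auto simp: br_add_left br_add_right br_scale_left br_scale_right abel)
  moreover have "br (br u v) w = 0" for u v w by (rule leib_central_left[OF central])
  ultimately have J: "ideal_of ?J UNIV" by (simp add: ideal_of_def)
  have "abelian ?J" using abel by (simp add: abelian_def)
  have leib: "leib = span {br y y}"
  proof
    show "leib \<subseteq> span {br y y}"
      unfolding leib_def using squares_dependent[OF central y] by (intro span_minimal) auto
    show "span {br y y} \<subseteq> leib"
      by (rule span_minimal) (auto simp: square_in_leib subspace_leib)
  qed
  have yC: "br y y \<in> center UNIV" by (simp add: center_def)
  \<comment> \<open>Choose \<open>E\<close> to meet the center of the whole algebra only in the line
    of \<open>br y y\<close>; the rest of the center goes into \<open>Z\<close>.\<close>
  obtain E Z where EZ: "subspace E" "subspace Z" "br y y \<in> E" "Z \<subseteq> center UNIV"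
      "center UNIV \<inter> E = span {br y y}" "UNIV = E + Z" "E \<inter> Z = {0}"
    using exists_complement_in_subspace[OF subspace_center[OF subspace_UNIV] yC y] by blast
  have leibE: "leib \<subseteq> E" unfolding leib using EZ by (intro span_minimal) auto
  have cE: "center E = span {br y y}"
  proof
    show "span {br y y} \<subseteq> center E"
      using leibE unfolding leib[symmetric] by (auto simp: center_def)
    show "center E \<subseteq> span {br y y}"
    proof
      fix e assume e: "e \<in> center E"
      \<comment> \<open>What is central in \<open>E\<close> is central everywhere, since the
        complement \<open>Z\<close> is central.\<close>
      have "br e x = 0 \<and> br x e = 0" for x
      proof -
        have "x \<in> E + Z" using EZ by blast
        then obtain f z where "f \<in> E" "z \<in> Z" "x = f + z" by (auto simp: set_plus_def)
        then show ?thesis using e EZ(4) by (auto simp: br_simps center_def)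
      qed
      then have "e \<in> center UNIV \<inter> E" using e by (auto simp: center_def)
      then show "e \<in> span {br y y}" using EZ by simp
    qed
  qed
  have iZ: "ideal_of Z UNIV"
    using EZ(2,4) subspace_0[OF EZ(2)] by (auto simp: ideal_of_def center_def subset_iff)
  moreover have iE: "ideal_of E UNIV"
    using EZ central leibE by (auto simp: ideal_of_def)
  ultimately have "direct_sum UNIV E Z" using EZ by (simp add: direct_sum_def)
  moreover have "central_ideal_of Z UNIV" using iZ EZ by (simp add: central_ideal_of_def)
  moreover have "extraspecial E"
    unfolding extraspecial_def abelian_quotient_center_iff[OF EZ(1)]
  proof (intro conjI ballI)
    show "subalgebra E" using EZ(1) leibE central by (auto simp: subalgebra_def)
    show "dim (center E) = 1" using y by (simp add: cE)
    show "br u v \<in> center E" for u v using central unfolding cE leib by blast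
  qed
  ultimately show ?thesis using J \<open>abelian ?J\<close> by blast
qed

end

section \<open>Modularity of the algebras in the list\<close>

context nonassoc_algebra
begin

text \<open>Each product is a linear combination of its two factors, so every subspace is a
  subalgebra and the dichotomy is trivial.\<close>

lemma modular_if_almost_abelian_lie:
  assumes "almost_abelian_lie UNIV"
  shows "modular UNIV"
proof -
  obtain A y where A: "UNIV = A + span {y}" "subspace A" "abelian A"
      "\<And>a. a \<in> A \<Longrightarrow> br a y = a" "\<And>a. a \<in> A \<Longrightarrow> br y a = - a" and sq: "\<And>x. br x x = 0"
    using assms unfolding almost_abelian_lie_def lie_algebra_def ideal_of_def
    by (metis UNIV_I minus_minus)
  have dec: "\<exists>a\<in>A. \<exists>p. x = a + p *s y" for x
  proof -
    have "x \<in> A + span {y}" using A(1) by blast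
    then show ?thesis by (auto simp: set_plus_def span_singleton)
  qed
  have "\<exists>p q. br u v = p *s u + q *s v" for u v
  proof -
    obtain a p where u: "a \<in> A" "u = a + p *s y" using dec by blast
    obtain b q where v: "b \<in> A" "v = b + q *s y" using dec by blast
    \<comment> \<open>The product is \<open>q *s a - p *s b\<close>; the multiples of
      \<open>y\<close> on the right cancel.\<close>
    have "br u v = q *s u + (- p) *s v"
      using u v A(3-5) sq[of y] by (simp add: br_simps abelian_def algebra_simps)
    then show ?thesis by blast
  qed
  then have "subalgebra S" if "subspace S" for S
    using that unfolding subalgebra_def by (metis subspace_add subspace_scale)
  then show ?thesis by (intro modular_of_dichotomy[of UNIV 0]) auto
qed

text \<open>All products lie in the line \<open>Fz = center E\<close>. A subspace containing
  \<open>z\<close> is therefore closed, as is one of elements of square zero; a subalgebra with a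
  nonzero square contains \<open>z\<close>.\<close>

lemma modular_if_extraspecial_sum:
  assumes "direct_sum UNIV E Z" "central_ideal_of Z UNIV" "extraspecial E"
    and J: "ideal_of {x. br x x = 0} UNIV" "abelian {x. br x x = 0}"
  shows "modular UNIV"
proof -
  have E: "subalgebra E" "dim (center E) = 1" using assms by (auto simp: extraspecial_def)
  have sE: "subspace E" using E by (simp add: subalgebra_subspace)
  have EZ: "UNIV = E + Z" "Z \<subseteq> center UNIV"
    using assms by (auto simp: direct_sum_def central_ideal_of_def)
  have Z: "br c w = 0" "br w c = 0" if "c \<in> Z" for c w
    using that EZ(2) by (auto simp: center_def)
  obtain T where T: "T \<subseteq> center E" "center E \<subseteq> span T" "card T = 1"
    using basis_exists[of "center E"] E(2) by metis
  then obtain z where z: "center E \<subseteq> span {z}" by (metis card_1_singletonE)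
  have br: "br u v \<in> span {z}" for u v
  proof -
    have "u \<in> E + Z" "v \<in> E + Z" using EZ by blast+
    then obtain e c f d where "e \<in> E" "c \<in> Z" "u = e + c" "f \<in> E" "d \<in> Z" "v = f + d"
      by (auto simp: set_plus_def)
    moreover from this have "br u v = br e f" by (simp add: br_simps Z)
    moreover have "\<forall>e\<in>E. \<forall>f\<in>E. br e f \<in> center E"
      using assms abelian_quotient_center_iff[OF sE] by (auto simp: extraspecial_def)
    ultimately show ?thesis using z by auto
  qed
  show ?thesis
  proof (rule modular_of_dichotomy[of "{x. br x x = 0}" z])
    show "subspace {x. br x x = 0}" using J by (simp add: ideal_of_def)
    show "subalgebra S" if "subspace S" "S \<subseteq> {x. br x x = 0} \<or> z \<in> S" for S
      using that(2)
    proof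
      assume "S \<subseteq> {x. br x x = 0}"
      then show ?thesis using J(2) that(1) subspace_0[OF that(1)]
        by (auto simp: subalgebra_def abelian_def subset_iff)
    next
      assume "z \<in> S"
      then have "span {z} \<subseteq> S" using that(1) by (intro span_minimal) auto
      then show ?thesis using br that(1) by (auto simp: subalgebra_def)
    qed
    show "U \<subseteq> {x. br x x = 0} \<or> z \<in> U" if U: "subalgebra U" for U
    proof (rule disjCI)
      assume "z \<notin> U"
      show "U \<subseteq> {x. br x x = 0}"
      proof
        fix x assume "x \<in> U"
        obtain k where k: "br x x = k *s z" using br[of x x] by (auto simp: span_singleton)
        have "k = 0"
        proof (rule ccontr)
          assume "k \<noteq> 0"
          have "inverse k *s br x x \<in> U"
            using U \<open>x \<in> U\<close> by (auto simp: subalgebra_def intro: subspace_scale)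
          then show False using k \<open>k \<noteq> 0\<close> \<open>z \<notin> U\<close> by simp
        qed
        then show "x \<in> {x. br x x = 0}" using k by simp
      qed
    qed
  qed
qed

text \<open>The dichotomy holds with \<open>J = B + F br y y\<close>, where products vanish, and
  \<open>z = br y y\<close>: modulo \<open>z\<close> each product is a combination of its
  factors.\<close>

lemma modular_if_almost_abelian_extension:
  assumes L: "UNIV = B + span {y} + span {br y y}" and B: "subspace B" "abelian B"
    and eig: "\<And>b. b \<in> B \<Longrightarrow> br b y = b" "\<And>b. b \<in> B \<Longrightarrow> br y b = - b"
    and central: "br y y \<in> center UNIV"
  shows "modular UNIV"
proof -
  let ?z = "br y y"
  have z: "br ?z x = 0" "br x ?z = 0" for x using central by (auto simp: center_def)
  have dec: "\<exists>b\<in>B. \<exists>p q. x = b + p *s y + q *s ?z" for x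
  proof -
    have "x \<in> B + span {y} + span {?z}" using L by blast
    then show ?thesis by (force simp: set_plus_def span_singleton)
  qed
  have br: "\<exists>p q r. br u v = p *s u + q *s v + r *s ?z" for u v
  proof -
    obtain b p q where u: "b \<in> B" "u = b + p *s y + q *s ?z" using dec by blast
    obtain c r s where v: "c \<in> B" "v = c + r *s y + s *s ?z" using dec by blast
    have "br u v = r *s u + (- p) *s v + (p * r - r * q + p * s) *s ?z"
      using u v B(2) eig by (simp add: br_simps z abelian_def algebra_simps)
    then show ?thesis by blast
  qed
  let ?J = "B + span {?z}"
  have J: "br u v = 0" if "u \<in> ?J" "v \<in> ?J" for u v
    using that B(2) z by (force simp: set_plus_def span_singleton abelian_def br_simps)
  show ?thesis
  proof (rule modular_of_dichotomy[of ?J ?z])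
    show "subspace ?J" using B by (intro subspace_set_plus) auto
    show "subalgebra S" if "subspace S" "S \<subseteq> ?J \<or> ?z \<in> S" for S
      using that(2)
    proof
      assume "S \<subseteq> ?J"
      then show ?thesis using J that(1) subspace_0[OF that(1)]
        by (auto simp: subalgebra_def subset_iff)
    next
      assume "?z \<in> S"
      then show ?thesis using br that(1) unfolding subalgebra_def by (metis subspace_add subspace_scale)
    qed
    show "U \<subseteq> ?J \<or> ?z \<in> U" if U: "subalgebra U" for U
    proof (rule disjCI)
      assume "?z \<notin> U"
      show "U \<subseteq> ?J"
      proof
        fix x assume "x \<in> U"
        obtain b p q where x: "b \<in> B" "x = b + p *s y + q *s ?z" using dec by blast
        \<comment> \<open>A subalgebra omitting \<open>?z\<close> thus has no element with a nonzero
          \<open>y\<close>-coefficient \<open>p\<close>.\<close>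
        have "br x x = (p * p) *s ?z"
          using x B(2) eig by (simp add: br_simps z abelian_def algebra_simps)
        moreover have "inverse (p * p) *s br x x \<in> U"
          using U \<open>x \<in> U\<close> by (auto simp: subalgebra_def intro: subspace_scale)
        ultimately have "p = 0" using \<open>?z \<notin> U\<close> by (cases "p = 0") (auto simp del: inverse_mult_distrib)
        have "q *s ?z \<in> span {?z}" by (simp add: span_base span_scale)
        then have "b + q *s ?z \<in> ?J" by (intro set_plus_intro x(1))
        then show "x \<in> ?J" using x(2) \<open>p = 0\<close> by simp
      qed
    qed
  qed
qed

end

theorem theorem4p1:
  fixes scale :: "'f::alg_closed_field \<Rightarrow> 'v::ab_group_add \<Rightarrow> 'v"
    and br :: "'v \<Rightarrow> 'v \<Rightarrow> 'v"
    and Basis :: "'v set"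
  assumes "finite_dimensional_symmetric_leibniz_algebra scale br Basis"
    and "CHAR('f) \<noteq> 2"
  shows "nonassoc_algebra.modular scale br UNIV \<longleftrightarrow>
     (nonassoc_algebra.lie_algebra scale br UNIV \<and> nonassoc_algebra.abelian br UNIV)
   \<or> nonassoc_algebra.almost_abelian_lie scale br UNIV
   \<or> (\<exists>E Z. nonassoc_algebra.direct_sum scale br UNIV E Z
        \<and> nonassoc_algebra.central_ideal_of scale br Z UNIV
        \<and> nonassoc_algebra.extraspecial scale br E
        \<and> nonassoc_algebra.ideal_of scale br {x. br x x = 0} UNIV
        \<and> nonassoc_algebra.abelian br {x. br x x = 0})
   \<or> (\<exists>B y. UNIV = B + module.span scale {y} + module.span scale {br y y}
        \<and> nonassoc_algebra.ideal_of scale br B UNIV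
        \<and> nonassoc_algebra.abelian br B
        \<and> (\<forall>b\<in>B. br b y = b \<and> b = - br y b)
        \<and> nonassoc_algebra.center br UNIV = module.span scale {br y y})"
proof -
  interpret finite_dimensional_symmetric_leibniz_algebra scale br Basis by fact
  \<comment> \<open>Otherwise the characteristic divides 2; it is neither 0, nor 1, nor by
    assumption 2.\<close>
  have two: "(2 :: 'f) \<noteq> 0"
  proof
    assume "(2 :: 'f) = 0"
    then have "of_nat 2 = (0 :: 'f)" by simp
    then have dvd: "CHAR('f) dvd 2" by (simp only: of_nat_eq_0_iff_char_dvd)
    then have "CHAR('f) \<le> 2" by (rule dvd_imp_le) simp
    moreover have "CHAR('f) \<noteq> 0" using dvd by (metis dvd_0_left_iff zero_neq_numeral)
    moreover have "CHAR('f) \<noteq> 1" by simp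
    ultimately show False using assms(2) by linarith
  qed
  show ?thesis
  proof (intro iffI)
    assume "modular UNIV"
    then interpret modular_leibniz_algebra scale br Basis
      using two by unfold_locales
    show "(lie_algebra UNIV \<and> abelian UNIV) \<or> almost_abelian_lie UNIV \<or>
      (\<exists>E Z. direct_sum UNIV E Z \<and> central_ideal_of Z UNIV \<and> extraspecial E
        \<and> ideal_of {x. br x x = 0} UNIV \<and> abelian {x. br x x = 0}) \<or>
      (\<exists>B y. UNIV = B + span {y} + span {br y y} \<and> ideal_of B UNIV \<and> abelian B
        \<and> (\<forall>b\<in>B. br b y = b \<and> b = - br y b) \<and> center UNIV = span {br y y})"
    proof (cases "\<forall>x y. br x y \<in> leib")
      case False
      then show ?thesis using nonabelian_mod_leib_structure by blast
    next
      case True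
      show ?thesis
      proof (cases "\<exists>y. br y y \<noteq> 0")
        case ex: True
        then show ?thesis using abelian_mod_leib_structure True by blast
      next
        case False
        then have "range (\<lambda>x. br x x) = {0}" by auto
        then have "leib = {0}" by (simp add: leib_def)
        then have "br x y = 0" for x y using True by simp
        then have "lie_algebra UNIV \<and> abelian UNIV"
          by (simp add: lie_algebra_def subalgebra_def abelian_def)
        then show ?thesis by blast
      qed
    qed
  next
    assume "(lie_algebra UNIV \<and> abelian UNIV) \<or> almost_abelian_lie UNIV \<or>
      (\<exists>E Z. direct_sum UNIV E Z \<and> central_ideal_of Z UNIV \<and> extraspecial E
        \<and> ideal_of {x. br x x = 0} UNIV \<and> abelian {x. br x x = 0}) \<or>
      (\<exists>B y. UNIV = B + span {y} + span {br y y} \<and> ideal_of B UNIV \<and> abelian B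
        \<and> (\<forall>b\<in>B. br b y = b \<and> b = - br y b) \<and> center UNIV = span {br y y})"
    then show "modular UNIV"
    proof (elim disjE exE conjE)
      assume "abelian UNIV"
      \<comment> \<open>With zero products every subspace is closed, so the whole space can serve as
        \<open>J\<close>.\<close>
      then show ?thesis
        by (intro modular_of_dichotomy[of UNIV 0])
          (auto simp: abelian_def subalgebra_def subspace_0)
    next
      assume "almost_abelian_lie UNIV"
      then show ?thesis by (rule modular_if_almost_abelian_lie)
    next
      fix E Z
      assume "direct_sum UNIV E Z" "central_ideal_of Z UNIV" "extraspecial E"
        "ideal_of {x. br x x = 0} UNIV" "abelian {x. br x x = 0}"
      then show ?thesis by (rule modular_if_extraspecial_sum)
    next
      fix B y
      assume L: "UNIV = B + span {y} + span {br y y}" "ideal_of B UNIV" "abelian B"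
        "\<forall>b\<in>B. br b y = b \<and> b = - br y b" "center UNIV = span {br y y}"
      show ?thesis
      proof (rule modular_if_almost_abelian_extension[OF L(1) _ L(3)])
        show "subspace B" using L by (simp add: ideal_of_def)
        show "br b y = b" "br y b = - b" if "b \<in> B" for b
          using L(4) that by (blast, metis minus_minus)
        show "br y y \<in> center UNIV" using L(5) by (simp add: span_base)
      qed
    qed
  qed
qed

end
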